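(* Let $n$ be a positive integer, and let $p$ and $q$ be distinct odd primes not dividing $n$. Then $pq=x^2+ny^2$ for some $x,y\in\mathbb{Z}$ if and only if there is a reduced form of discriminant $-4n$ which represents both $p$ and $q$.
   Context: A form is an integral binary quadratic form $f(x,y)=ax^2+bxy+cy^2$ with $a,b,c\in\mathbb{Z}$; its discriminant is $b^2-4ac$. It is primitive if $\gcd(a,b,c)=1$. An integer $m$ is represented by $f$ if $m=f(x,y)$ for some $x,y\in\mathbb{Z}$. A reduced form is a primitive positive definite form $ax^2+bxy+cy^2$ whose coefficients satisfy $|b|\le a\le c$, and $b\ge 0$ if either $|b|=a$ or $a=c$. *)

theory Defs
  imports "HOL-Computational_Algebra.Primes"
begin

datatype bqf = BQF (coeff_a: int) (coeff_b: int) (coeff_c: int)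

definition bqf_eval :: "bqf \<Rightarrow> int \<Rightarrow> int \<Rightarrow> int" where
  "bqf_eval f x y = coeff_a f * x\<^sup>2 + coeff_b f * x * y + coeff_c f * y\<^sup>2"

definition bqf_disc :: "bqf \<Rightarrow> int" where
  "bqf_disc f = (coeff_b f)\<^sup>2 - 4 * coeff_a f * coeff_c f"

definition bqf_primitive :: "bqf \<Rightarrow> bool" where
  "bqf_primitive f \<longleftrightarrow> gcd (coeff_a f) (gcd (coeff_b f) (coeff_c f)) = 1"

definition bqf_represents :: "bqf \<Rightarrow> int \<Rightarrow> bool" where
  "bqf_represents f m \<longleftrightarrow> (\<exists>x y. m = bqf_eval f x y)"

(* Positivity is required at integer arguments only; for integral forms this is
   equivalent to positivity at all nonzero real arguments. *)
definition bqf_pos_def :: "bqf \<Rightarrow> bool" where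
  "bqf_pos_def f \<longleftrightarrow> (\<forall>x y. (x, y) \<noteq> (0, 0) \<longrightarrow> bqf_eval f x y > 0)"

definition bqf_reduced :: "bqf \<Rightarrow> bool" where
  "bqf_reduced f \<longleftrightarrow>
     bqf_primitive f \<and> bqf_pos_def f \<and>
     \<bar>coeff_b f\<bar> \<le> coeff_a f \<and> coeff_a f \<le> coeff_c f \<and>
     (\<bar>coeff_b f\<bar> = coeff_a f \<or> coeff_a f = coeff_c f \<longrightarrow> coeff_b f \<ge> 0)"

end

theory Submission
  imports Defs
begin

text \<open>
  If $f = ax^2 + 2bxy + cy^2$ has discriminant $-4n$ and polar form $B$, then
  $f(X) f(U) = B(X,U)^2 + n \det(X,U)^2$, which gives one direction. Conversely, if
  $pq = x^2 + ny^2$, choose $b$ with $by \equiv x \pmod p$. Then $p \mid b^2 + n$, the form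
  $(p, 2b, (b^2+n)/p)$ represents $p$, and it takes the value $q$ at $((x-by)/p, y)$. Among
  the forms equivalent to it, one minimising $a + |b|$ is reduced up to the sign of $b$.
\<close>

lemma bqf_primitive_iff:
  "bqf_primitive f \<longleftrightarrow>
     (\<forall>d. d dvd coeff_a f \<longrightarrow> d dvd coeff_b f \<longrightarrow> d dvd coeff_c f \<longrightarrow> is_unit d)"
proof -
  have "bqf_primitive f \<longleftrightarrow> is_unit (gcd (coeff_a f) (gcd (coeff_b f) (coeff_c f)))"
    unfolding bqf_primitive_def by simp
  also have "\<dots> \<longleftrightarrow>
     (\<forall>d. d dvd coeff_a f \<longrightarrow> d dvd coeff_b f \<longrightarrow> d dvd coeff_c f \<longrightarrow> is_unit d)"
    by (meson dvd_trans gcd_dvd1 gcd_dvd2 gcd_greatest)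
  finally show ?thesis .
qed

text \<open>The action of the matrix in SL_2(Z) that sends (x, y) to (-y, x). Together with the
  translations behind \<open>bqf_shift\<close> it generates SL_2(Z).\<close>

definition bqf_swap :: "bqf \<Rightarrow> bqf" where
  "bqf_swap f = BQF (coeff_c f) (- coeff_b f) (coeff_a f)"

definition bqf_shift :: "int \<Rightarrow> bqf \<Rightarrow> bqf" where
  "bqf_shift k f =
     BQF (coeff_a f) (coeff_b f + 2 * k * coeff_a f) (coeff_a f * k\<^sup>2 + coeff_b f * k + coeff_c f)"

lemma bqf_eval_swap: "bqf_eval (bqf_swap f) x y = bqf_eval f (- y) x"
  by (simp add: bqf_eval_def bqf_swap_def)

lemma bqf_eval_shift: "bqf_eval (bqf_shift k f) x y = bqf_eval f (x + k * y) y"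
  by (simp add: bqf_eval_def bqf_shift_def power2_eq_square algebra_simps)

text \<open>The part of proper equivalence of forms that the reduction needs.\<close>

definition bqf_similar :: "bqf \<Rightarrow> bqf \<Rightarrow> bool" where
  "bqf_similar f g \<longleftrightarrow>
     (bqf_primitive f \<longrightarrow> bqf_primitive g) \<and> (bqf_pos_def f \<longrightarrow> bqf_pos_def g) \<and>
     bqf_disc g = bqf_disc f \<and> bqf_represents g = bqf_represents f"

lemma bqf_similar_refl: "bqf_similar f f"
  by (simp add: bqf_similar_def)

lemma bqf_similar_trans: "bqf_similar f g \<Longrightarrow> bqf_similar g h \<Longrightarrow> bqf_similar f h"
  by (simp add: bqf_similar_def)

lemma bqf_similar_swap: "bqf_similar f (bqf_swap f)"
  unfolding bqf_similar_def
proof (intro conjI impI)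
  show "bqf_primitive (bqf_swap f)" if "bqf_primitive f"
    using that by (auto simp: bqf_primitive_iff bqf_swap_def)
  show "bqf_pos_def (bqf_swap f)" if "bqf_pos_def f"
    unfolding bqf_pos_def_def bqf_eval_swap
  proof (intro allI impI)
    fix x y :: int assume "(x, y) \<noteq> (0, 0)"
    then have "(- y, x) \<noteq> (0, 0)" by auto
    with that show "bqf_eval f (- y) x > 0" unfolding bqf_pos_def_def by blast
  qed
  show "bqf_disc (bqf_swap f) = bqf_disc f"
    by (simp add: bqf_disc_def bqf_swap_def)
  show "bqf_represents (bqf_swap f) = bqf_represents f"
    unfolding bqf_represents_def bqf_eval_swap by (metis minus_minus)
qed

lemma bqf_similar_shift: "bqf_similar f (bqf_shift k f)"
  unfolding bqf_similar_def
proof (intro conjI impI)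
  show "bqf_primitive (bqf_shift k f)" if "bqf_primitive f"
    unfolding bqf_primitive_iff
  proof (intro allI impI)
    fix d
    assume a: "d dvd coeff_a (bqf_shift k f)" and b: "d dvd coeff_b (bqf_shift k f)"
      and c: "d dvd coeff_c (bqf_shift k f)"
    have da: "d dvd coeff_a f" using a by (simp add: bqf_shift_def)
    then have db: "d dvd coeff_b f"
      using b by (simp add: bqf_shift_def dvd_add_left_iff)
    have "d dvd coeff_c f"
      using c da db by (simp add: bqf_shift_def dvd_add_right_iff)
    with da db that show "is_unit d" unfolding bqf_primitive_iff by blast
  qed
  show "bqf_pos_def (bqf_shift k f)" if "bqf_pos_def f"
    unfolding bqf_pos_def_def bqf_eval_shift
  proof (intro allI impI)
    fix x y :: int assume "(x, y) \<noteq> (0, 0)"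
    then have "(x + k * y, y) \<noteq> (0, 0)" by auto
    with that show "bqf_eval f (x + k * y) y > 0" unfolding bqf_pos_def_def by blast
  qed
  show "bqf_disc (bqf_shift k f) = bqf_disc f"
    by (simp add: bqf_disc_def bqf_shift_def power2_eq_square algebra_simps)
  \<comment> \<open>The substitution is invertible over the integers, with inverse (x, y) to (x - k
    y, y), so no value is gained or lost.\<close>
  show "bqf_represents (bqf_shift k f) = bqf_represents f"
    unfolding bqf_represents_def bqf_eval_shift by (metis diff_add_cancel)
qed

lemma bqf_pos_def_coeff_pos:
  assumes "bqf_pos_def f"
  shows "coeff_a f > 0" "coeff_c f > 0"
proof -
  have "bqf_eval f 1 0 > 0" "bqf_eval f 0 1 > 0"
    using assms by (simp_all add: bqf_pos_def_def)
  then show "coeff_a f > 0" "coeff_c f > 0"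
    by (simp_all add: bqf_eval_def)
qed

text \<open>Well-ordering replaces a terminating reduction algorithm: each inequality of a reduced
  form says that one swap or shift cannot lower the measure, and at most one more move corrects the
  sign of the middle coefficient.\<close>

lemma exists_similar_reduced:
  assumes "bqf_primitive f" "bqf_pos_def f"
  obtains g where "bqf_reduced g" "bqf_similar f g"
proof -
  define \<mu> where "\<mu> = (\<lambda>g. nat (coeff_a g + \<bar>coeff_b g\<bar>))"
  obtain g where sim: "bqf_similar f g" and least: "\<And>h. bqf_similar f h \<Longrightarrow> \<mu> g \<le> \<mu> h"
    using ex_has_least_nat[of "bqf_similar f" f \<mu>] bqf_similar_refl by blast
  \<comment> \<open>Positivity makes the \<open>nat\<close> in \<open>\<mu>\<close> lossless on all
    forms similar to \<open>f\<close>.\<close>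
  have pos: "coeff_a h > 0" "coeff_c h > 0" if "bqf_similar f h" for h
    using that assms bqf_pos_def_coeff_pos by (auto simp: bqf_similar_def)
  have min: "coeff_a g + \<bar>coeff_b g\<bar> \<le> coeff_a h + \<bar>coeff_b h\<bar>" if "bqf_similar g h" for h
  proof -
    have "bqf_similar f h" using sim that by (rule bqf_similar_trans)
    with least[of h] pos[of h] show ?thesis by (simp add: \<mu>_def)
  qed
  have ac: "coeff_a g \<le> coeff_c g"
    using min[OF bqf_similar_swap] by (simp add: bqf_swap_def)
  \<comment> \<open>The shifts by 1 and -1 keep a and turn b into b + 2a and b - 2a. If |b| > a, one
    of these would be smaller than b in absolute value.\<close>
  have ba: "\<bar>coeff_b g\<bar> \<le> coeff_a g"
    using min[OF bqf_similar_shift[of g 1]] min[OF bqf_similar_shift[of g "-1"]] pos[OF sim]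
    by (simp add: bqf_shift_def)
  have reducedI: "bqf_reduced h"
    if "bqf_similar f h" "\<bar>coeff_b h\<bar> \<le> coeff_a h" "coeff_a h \<le> coeff_c h"
      "\<bar>coeff_b h\<bar> = coeff_a h \<or> coeff_a h = coeff_c h \<longrightarrow> coeff_b h \<ge> 0" for h
    using that assms by (simp add: bqf_reduced_def bqf_similar_def)
  consider "\<bar>coeff_b g\<bar> = coeff_a g \<or> coeff_a g = coeff_c g \<longrightarrow> coeff_b g \<ge> 0"
    | "coeff_b g < 0" "coeff_b g = - coeff_a g" | "coeff_b g < 0" "coeff_a g = coeff_c g"
    by linarith
  then show ?thesis
  proof cases
    case 1
    then show ?thesis using that sim reducedI ac ba by blast
  next
    case 2
    \<comment> \<open>This shift sends (a, -a, c) to (a, a, c).\<close>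
    have "bqf_similar f (bqf_shift 1 g)"
      using sim bqf_similar_shift by (rule bqf_similar_trans)
    moreover have "bqf_reduced (bqf_shift 1 g)"
      using calculation by (rule reducedI) (use 2 ac in \<open>simp_all add: bqf_shift_def\<close>)
    ultimately show ?thesis using that by blast
  next
    case 3
    \<comment> \<open>With equal outer coefficients, the swap only changes the sign of b.\<close>
    have "bqf_similar f (bqf_swap g)"
      using sim bqf_similar_swap by (rule bqf_similar_trans)
    moreover have "bqf_reduced (bqf_swap g)"
      using calculation by (rule reducedI) (use 3 ba in \<open>simp_all add: bqf_swap_def\<close>)
    ultimately show ?thesis using that by blast
  qed
qed

text \<open>This is a Gram determinant: f(X) f(U) - B(X,U)^2 is the determinant ac - b^2 = n of the
  matrix of \<open>f\<close>, times det(X,U)^2. The middle coefficient is even because the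
  discriminant is divisible by 4.\<close>

lemma bqf_represents_product:
  assumes "bqf_disc f = - 4 * n" "bqf_represents f k" "bqf_represents f m"
  shows "\<exists>x y. k * m = x\<^sup>2 + n * y\<^sup>2"
proof -
  obtain x y u v where k: "k = bqf_eval f x y" and m: "m = bqf_eval f u v"
    using assms by (auto simp: bqf_represents_def)
  obtain a c where ac: "a = coeff_a f" "c = coeff_c f" by blast
  have disc: "(coeff_b f)\<^sup>2 = 4 * (a * c - n)"
    using assms(1) by (simp add: bqf_disc_def ac)
  then have "even ((coeff_b f)\<^sup>2)" by simp
  then obtain b where b: "coeff_b f = 2 * b" by (auto elim: evenE)
  have n: "n = a * c - b\<^sup>2" using disc by (simp add: b power2_eq_square)
  have "k * m = (a * x * u + b * (x * v + y * u) + c * y * v)\<^sup>2 + n * (x * v - y * u)\<^sup>2"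
    unfolding k m n bqf_eval_def b ac[symmetric] by algebra
  then show ?thesis by blast
qed

lemma exists_form_representing_factors:
  fixes n p q :: int
  assumes "n > 0" "prime p" "\<not> p dvd q" "odd p" "\<not> p dvd n"
    and pq: "p * q = x\<^sup>2 + n * y\<^sup>2"
  obtains f where "bqf_primitive f" "bqf_pos_def f" "bqf_disc f = - 4 * n"
    "bqf_represents f p" "bqf_represents f q"
proof -
  have p: "p > 0" using \<open>prime p\<close> by (simp add: prime_gt_0_int)
  \<comment> \<open>Otherwise p divides x as well, so p^2 divides pq and p divides q.\<close>
  have "\<not> p dvd y"
  proof
    assume y: "p dvd y"
    then have "p dvd n * y\<^sup>2" by (simp add: power2_eq_square)
    moreover have "p dvd x\<^sup>2 + n * y\<^sup>2" by (simp flip: pq)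
    ultimately have "p dvd x\<^sup>2" by (simp add: dvd_add_left_iff)
    then have "p dvd x" using \<open>prime p\<close> prime_dvd_power by blast
    with y have "p * p dvd p * q"
      unfolding pq power2_eq_square by (intro dvd_add dvd_mult mult_dvd_mono)
    with p \<open>\<not> p dvd q\<close> show False by simp
  qed
  then have "coprime p y" using \<open>prime p\<close> by (simp add: prime_imp_coprime)
  then obtain s t where "s * p + t * y = 1"
    using bezout_int[of p y] by auto
  \<comment> \<open>By the Bezout relation t inverts y modulo p, so b y is congruent to x; u is the
    quotient (x - b y) / p.\<close>
  define b where "b = t * x"
  define u where "u = s * x"
  have x: "x = p * u + b * y"
  proof -
    have "x = (s * p + t * y) * x" using \<open>s * p + t * y = 1\<close> by simp
    then show ?thesis by (simp add: b_def u_def algebra_simps)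
  qed
  have "y\<^sup>2 * (b\<^sup>2 + n) = p * (q - p * u\<^sup>2 - 2 * u * b * y)"
    using pq x by algebra
  then have "p dvd y\<^sup>2 * (b\<^sup>2 + n)" by simp
  then have "p dvd b\<^sup>2 + n"
    using \<open>prime p\<close> \<open>\<not> p dvd y\<close> by (meson prime_dvd_mult_iff prime_dvd_power)
  then obtain c where c: "b\<^sup>2 + n = p * c" by blast
  define f where "f = BQF p (2 * b) c"
  \<comment> \<open>Completing the square serves twice: the right side is positive away from the
    origin, and at (u, y) it equals x^2 + n y^2 = pq, which gives the value q.\<close>
  have mult: "p * bqf_eval f z w = (p * z + b * w)\<^sup>2 + n * w\<^sup>2" for z w
    unfolding bqf_eval_def f_def using c by (simp, algebra)
  have "bqf_primitive f"
    unfolding bqf_primitive_iff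
  proof (intro allI impI)
    fix d assume "d dvd coeff_a f" and "d dvd coeff_b f"
    then have d: "d dvd p" "d dvd 2 * b" by (simp_all add: f_def)
    show "is_unit d"
    proof (rule ccontr)
      assume "\<not> is_unit d"
      \<comment> \<open>A non-unit divisor of a prime is associated to it. As p is odd, p then
        divides b, hence also n = (b^2 + n) - b^2, a contradiction.\<close>
      then have "p dvd d" using d(1) \<open>prime p\<close>
        by (metis irreducible_altdef prime_elem_imp_irreducible prime_imp_prime_elem)
      then have "p dvd 2 * b" using d(2) dvd_trans by blast
      moreover have "\<not> p dvd 2"
        using \<open>prime p\<close> \<open>odd p\<close> primes_dvd_imp_eq[of p 2] by auto
      ultimately have "p dvd b\<^sup>2"
        using \<open>prime p\<close> by (simp add: prime_dvd_mult_iff power2_eq_square)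
      with \<open>p dvd b\<^sup>2 + n\<close> \<open>\<not> p dvd n\<close> show False by (simp add: dvd_add_right_iff)
    qed
  qed
  moreover have "bqf_pos_def f"
    unfolding bqf_pos_def_def
  proof (intro allI impI)
    fix z w :: int assume zw: "(z, w) \<noteq> (0, 0)"
    have "(p * z + b * w)\<^sup>2 + n * w\<^sup>2 > 0"
    proof (cases "w = 0")
      case True
      then show ?thesis using zw p by simp
    next
      case False
      then show ?thesis using \<open>n > 0\<close> by (simp add: add_nonneg_pos)
    qed
    then show "bqf_eval f z w > 0"
      using p by (simp flip: mult add: zero_less_mult_iff)
  qed
  moreover have "bqf_disc f = - 4 * n"
    using c by (simp add: bqf_disc_def f_def power_mult_distrib)
  moreover have "p = bqf_eval f 1 0" by (simp add: bqf_eval_def f_def)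
  then have "bqf_represents f p" unfolding bqf_represents_def by blast
  moreover have "p * q = p * bqf_eval f u y" unfolding mult pq x ..
  then have "q = bqf_eval f u y" using p by simp
  then have "bqf_represents f q" unfolding bqf_represents_def by blast
  ultimately show ?thesis using that by blast
qed

theorem theorem4p1:
  fixes n p q :: int
  assumes "n > 0"
    and "prime p" and "prime q" and "odd p" and "odd q" and "p \<noteq> q"
    and "\<not> p dvd n" and "\<not> q dvd n"
  shows "(\<exists>x y :: int. p * q = x\<^sup>2 + n * y\<^sup>2) \<longleftrightarrow>
         (\<exists>f. bqf_reduced f \<and> bqf_disc f = - 4 * n \<and>
              bqf_represents f p \<and> bqf_represents f q)"
proof
  assume "\<exists>x y. p * q = x\<^sup>2 + n * y\<^sup>2"
  then obtain x y where xy: "p * q = x\<^sup>2 + n * y\<^sup>2" by blast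
  have "\<not> p dvd q" using assms primes_dvd_imp_eq by blast
  then obtain f where f: "bqf_primitive f" "bqf_pos_def f" "bqf_disc f = - 4 * n"
    "bqf_represents f p" "bqf_represents f q"
    using exists_form_representing_factors xy assms by blast
  then obtain g where "bqf_reduced g" "bqf_similar f g"
    using exists_similar_reduced by blast
  with f show "\<exists>f. bqf_reduced f \<and> bqf_disc f = - 4 * n \<and> bqf_represents f p \<and> bqf_represents f q"
    by (auto simp: bqf_similar_def)
next
  assume "\<exists>f. bqf_reduced f \<and> bqf_disc f = - 4 * n \<and> bqf_represents f p \<and> bqf_represents f q"
  then show "\<exists>x y. p * q = x\<^sup>2 + n * y\<^sup>2"
    using bqf_represents_product by blast
qed

end
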